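(* Let $G=\mathrm{GSp}(4)$, $\underline{k}=(k_1,k_2)$, and let $N$ satisfy $(N,11!)=1$. Assume GRH for the spinor $L$-functions $L(s,\pi_F,\mathrm{Spin})$, and let $r_F=\mathrm{ord}_{s=1/2}L(s,\pi_F,\mathrm{Spin})$ for $F\in HE_{\underline{k}}(N)$. Let $0<u<1$ be a number such that the one-level density formula recalled in the context holds for all test functions $\phi$ with $\hat\phi$ supported in $(-u,u)$, in the level aspect or weight aspect respectively. Then $$\frac1{d_{\underline{k}}(N)}\sum_{F\in HE_{\underline{k}}(N)}r_F\le\begin{cases}\frac1u+\frac12+O\big(\frac1{\log\log N}\big),&\text{level aspect},\\[2pt]\frac1u+\frac12+O\big(\frac1{\log((k_1-k_2+2)k_1k_2)}\big),&\text{weight aspect}.\end{cases}$$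
   Context: $HE_{\underline{k}}(N)$ is a basis, consisting of Hecke eigenforms outside $N$, of the space of holomorphic Siegel cusp forms of degree $2$ and weight $\underline{k}=(k_1,k_2)$, $k_1\ge k_2\ge3$, for the principal congruence subgroup $\Gamma(N)$ of level $N$; $d_{\underline{k}}(N)=|HE_{\underline{k}}(N)|$; $\pi_F$ is the cuspidal representation of $\mathrm{GSp}(4,\mathbb{A})$ attached to $F$; $L(s,\pi_F,\mathrm{Spin})$ is its degree $4$ spinor $L$-function (analytically normalized, with center $s=\frac12$). GRH: its non-trivial zeros are $\frac12+\sqrt{-1}\gamma_F$ with $\gamma_F\in\mathbb{R}$. Level aspect: $k_1,k_2$ fixed and $N\to\infty$. Weight aspect: $N$ fixed and $k_1+k_2\to\infty$. For an even test function $\phi$ put $D(\pi_F,\phi,\mathrm{Spin})=\sum_{\gamma_F}\phi\big(\frac{\gamma_F}{2\pi}\log c_{\underline{k},N}\big)$, the sum over non-trivial zeros with multiplicity, where $\log c_{\underline{k},N}$ is the average over $HE_{\underline{k}}(N)$ of the logarithms of the analytic conductors of $L(s,\pi_F,\mathrm{Spin})$. Known one-level density formula (for $(N,11!)=1$): there is $0<u<1$ such that for $\phi$ with Fourier transform $\hat\phi$ supported in $(-u,u)$, $$\frac1{d_{\underline{k}}(N)}\sum_{F\in HE_{\underline{k}}(N)}D(\pi_F,\phi,\mathrm{Spin})=\hat\phi(0)+\tfrac12\phi(0)+E,$$ with $E=O(\frac1{\log\log N})$ in the level aspect and $E=O\big(\frac1{\log((k_1-k_2+2)k_1k_2)}\big)$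 in the weight aspect. *)

theory Defs
  imports
    "HOL-Complex_Analysis.Complex_Analysis"
    "HOL-Library.Function_Algebras"
    "HOL-Library.Landau_Symbols"
    "HOL-Number_Theory.Cong"
begin

section \<open>Integral symplectic similitudes\<close>

text \<open>
  A 4 by 4 matrix is indexed by \<open>2 + 2\<close>, so that \<open>Inl\<close> and \<open>Inr\<close> address its 2 by 2 blocks.
\<close>

type_synonym mat4 = "int ^ (2 + 2) ^ (2 + 2)"
type_synonym mat2 = "complex ^ 2 ^ 2"

definition blockA :: "mat4 \<Rightarrow> mat2" where "blockA m = (\<chi> i j. of_int (m $ Inl i $ Inl j))"
definition blockB :: "mat4 \<Rightarrow> mat2" where "blockB m = (\<chi> i j. of_int (m $ Inl i $ Inr j))"
definition blockC :: "mat4 \<Rightarrow> mat2" where "blockC m = (\<chi> i j. of_int (m $ Inr i $ Inl j))"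
definition blockD :: "mat4 \<Rightarrow> mat2" where "blockD m = (\<chi> i j. of_int (m $ Inr i $ Inr j))"

definition sympl_form :: mat4 where
  "sympl_form = (\<chi> a b. case (a, b) of
       (Inl i, Inr j) \<Rightarrow> (if i = j then 1 else 0)
     | (Inr i, Inl j) \<Rightarrow> (if i = j then - 1 else 0)
     | _ \<Rightarrow> 0)"

definition GSp4_int :: "nat \<Rightarrow> mat4 set" where
  "GSp4_int \<nu> = {m. transpose m ** sympl_form ** m = mat (int \<nu>) ** sympl_form}"

text \<open>The matrix \<open>diag (1, 1, n, n)\<close>.\<close>

definition diag_11nn :: "nat \<Rightarrow> mat4" where
  "diag_11nn n = (\<chi> a b. if a = b then (case a of Inl _ \<Rightarrow> 1 | Inr _ \<Rightarrow> int n) else 0)"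

definition Hecke_matrices :: "nat \<Rightarrow> nat \<Rightarrow> mat4 set" where
  "Hecke_matrices N n = {m \<in> GSp4_int n. \<forall>a b. [m $ a $ b = diag_11nn n $ a $ b] (mod int N)}"

definition principal_congruence_subgroup :: "nat \<Rightarrow> mat4 set" where
  "principal_congruence_subgroup N = {m \<in> GSp4_int 1. \<forall>a b. [m $ a $ b = mat 1 $ a $ b] (mod int N)}"


section \<open>Vector-valued Siegel cusp forms of degree 2\<close>

definition siegel_H2 :: "mat2 set" where
  "siegel_H2 = {Z. transpose Z = Z \<and>
     (\<forall>x :: real ^ 2. x \<noteq> 0 \<longrightarrow> 0 < x \<bullet> ((\<chi> i j. Im (Z $ i $ j)) *v x))}"

definition siegel_act :: "mat4 \<Rightarrow> mat2 \<Rightarrow> mat2" where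
  "siegel_act m Z = (blockA m ** Z + blockB m) ** matrix_inv (blockC m ** Z + blockD m)"

text \<open>
  The representation space of \<open>Sym^j St \<otimes> det^l\<close> of \<open>GL(2, C)\<close> is the space of homogeneous
  polynomials \<open>P\<close> of degree \<open>j\<close> in a row vector \<open>v\<close> of length 2, with \<open>A\<close> acting by
  \<open>P(v) \<mapsto> det(A)^l P(v A)\<close>. A form of weight \<open>(k1, k2)\<close> has \<open>j = k1 - k2\<close> and \<open>l = k2\<close>;
  \<open>F Z v\<close> is the value at \<open>v\<close> of the polynomial \<open>F Z\<close>. Forms are set to 0 outside the Siegel
  upper half space, so that equality of forms is equality of HOL functions.
\<close>

type_synonym siegel_form = "mat2 \<Rightarrow> complex ^ 2 \<Rightarrow> complex"

definition homogeneous_poly :: "nat \<Rightarrow> (complex ^ 2 \<Rightarrow> complex) \<Rightarrow> bool" where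
  "homogeneous_poly j P \<longleftrightarrow> (\<exists>a. \<forall>v. P v = (\<Sum>i\<le>j. a i * (v $ 1) ^ (j - i) * (v $ 2) ^ i))"

text \<open>
  Holomorphy in the three independent entries: the real derivative along the symmetric
  matrices exists and is complex linear.
\<close>

definition siegel_holomorphic :: "(mat2 \<Rightarrow> complex) \<Rightarrow> bool" where
  "siegel_holomorphic f \<longleftrightarrow> (\<forall>Z \<in> siegel_H2. \<exists>D.
     (f has_derivative D) (at Z within {W. transpose W = W}) \<and>
     (\<forall>c W. D (\<chi> i j. c * W $ i $ j) = c * D W))"

text \<open>
  For \<open>m\<close> of similitude \<open>\<nu> > 0\<close>:
  \<open>(F | m)(Z) = \<nu>^((k1 + k2) / 2) \<rho>(C Z + D)^(-1) F(m Z)\<close>. With this power of \<open>\<nu>\<close>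
  positive scalar matrices act trivially (the unitary normalization).
\<close>

definition slash :: "nat \<Rightarrow> nat \<Rightarrow> nat \<Rightarrow> mat4 \<Rightarrow> siegel_form \<Rightarrow> siegel_form" where
  "slash k1 k2 \<nu> m F = (\<lambda>Z v.
     if Z \<in> siegel_H2 then
       (let j = blockC m ** Z + blockD m in
         complex_of_real (real \<nu> powr ((real k1 + real k2) / 2)) *
         inverse (det j ^ k2) * F (siegel_act m Z) (v v* matrix_inv j))
     else 0)"

text \<open>The diagonal matrix with entries \<open>z\<close>, \<open>w\<close>.\<close>

definition diag2 :: "complex \<Rightarrow> complex \<Rightarrow> mat2" where
  "diag2 z w = (\<chi> i j. if i = j then (if i = 1 then z else w) else 0)"

text \<open>
  Cuspidality: the Siegel operator kills \<open>F | g\<close> for every \<open>g\<close> in \<open>Sp(4, Z)\<close>. Holomorphy at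
  the cusps is automatic in degree 2 (Koecher).
\<close>

definition siegel_cusp_forms :: "nat \<Rightarrow> nat \<Rightarrow> nat \<Rightarrow> siegel_form set" where
  "siegel_cusp_forms k1 k2 N = {F.
     (\<forall>Z. Z \<notin> siegel_H2 \<longrightarrow> F Z = (\<lambda>_. 0)) \<and>
     (\<forall>Z. homogeneous_poly (k1 - k2) (F Z)) \<and>
     (\<forall>v. siegel_holomorphic (\<lambda>Z. F Z v)) \<and>
     (\<forall>g \<in> principal_congruence_subgroup N. slash k1 k2 1 g F = F) \<and>
     (\<forall>g \<in> GSp4_int 1. \<forall>z v. 0 < Im z \<longrightarrow>
        ((\<lambda>t. slash k1 k2 1 g F (diag2 z (\<i> * complex_of_real t)) v) \<longlongrightarrow> 0) at_top)}"

definition scale_form :: "complex \<Rightarrow> siegel_form \<Rightarrow> siegel_form" where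
  "scale_form c F = (\<lambda>Z v. c * F Z v)"


section \<open>Hecke operators outside N\<close>

text \<open>
  For a set \<open>S\<close> of integral matrices of similitude \<open>n\<close>, stable under \<open>\<Gamma>(N)\<close> on both sides:
  the sum of \<open>F | \<alpha>\<close> over representatives \<open>\<alpha>\<close> of \<open>\<Gamma>(N) \ S\<close>. For \<open>F\<close> modular the choice of
  representatives is immaterial.
\<close>

definition hecke_sum :: "nat \<Rightarrow> nat \<Rightarrow> nat \<Rightarrow> nat \<Rightarrow> mat4 set \<Rightarrow> siegel_form \<Rightarrow> siegel_form" where
  "hecke_sum k1 k2 N n S F =
     (\<Sum>c \<in> (\<lambda>\<alpha>. (\<lambda>g. g ** \<alpha>) ` principal_congruence_subgroup N) ` S.
        slash k1 k2 n (SOME \<alpha>. \<alpha> \<in> c) F)"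

definition double_coset :: "nat \<Rightarrow> mat4 \<Rightarrow> mat4 set" where
  "double_coset N m = {g ** m ** h | g h.
     g \<in> principal_congruence_subgroup N \<and> h \<in> principal_congruence_subgroup N}"

definition hecke_eigenform :: "nat \<Rightarrow> nat \<Rightarrow> nat \<Rightarrow> siegel_form \<Rightarrow> bool" where
  "hecke_eigenform k1 k2 N F \<longleftrightarrow>
     F \<in> siegel_cusp_forms k1 k2 N \<and> F \<noteq> 0 \<and>
     (\<forall>n>0. coprime n N \<longrightarrow> (\<forall>m \<in> Hecke_matrices N n. \<exists>c.
        hecke_sum k1 k2 N n (double_coset N m) F = scale_form c F))"

definition hecke_eigenbasis :: "nat \<Rightarrow> nat \<Rightarrow> nat \<Rightarrow> siegel_form set \<Rightarrow> bool" where
  "hecke_eigenbasis k1 k2 N B \<longleftrightarrow>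
     (\<forall>F \<in> B. hecke_eigenform k1 k2 N F) \<and>
     \<not> module.dependent scale_form B \<and>
     module.span scale_form B = siegel_cusp_forms k1 k2 N"

definition hecke_eigenvalue :: "nat \<Rightarrow> nat \<Rightarrow> nat \<Rightarrow> nat \<Rightarrow> mat4 set \<Rightarrow> siegel_form \<Rightarrow> complex" where
  "hecke_eigenvalue k1 k2 N n S F = (THE c. hecke_sum k1 k2 N n S F = scale_form c F)"

text \<open>The eigenvalue of the sum \<open>T(n)\<close> of all double cosets of similitude \<open>n\<close>.\<close>

definition hecke_T :: "nat \<Rightarrow> nat \<Rightarrow> nat \<Rightarrow> siegel_form \<Rightarrow> nat \<Rightarrow> complex" where
  "hecke_T k1 k2 N F n = hecke_eigenvalue k1 k2 N n (Hecke_matrices N n) F"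

text \<open>
  The value at \<open>p\<close> of the central character: the matrices in the set below are the \<open>p g\<close>
  with \<open>g \<in> Sp(4, Z)\<close>, \<open>g \<equiv> diag (1/p, 1/p, p, p) (mod N)\<close>.
\<close>

definition central_value :: "nat \<Rightarrow> nat \<Rightarrow> nat \<Rightarrow> siegel_form \<Rightarrow> nat \<Rightarrow> complex" where
  "central_value k1 k2 N F p =
     hecke_eigenvalue k1 k2 N (p\<^sup>2) {m \<in> Hecke_matrices N (p\<^sup>2). \<forall>a b. int p dvd m $ a $ b} F"


section \<open>The spinor L-function\<close>

text \<open>
  For \<open>p\<close> not dividing \<open>N\<close> the factor is \<open>1 / Q(p^(-s))\<close> with \<open>Q\<close> of degree 4 having the Satake
  parameters \<open>b\<close>, \<open>b b1\<close>, \<open>b b2\<close>, \<open>b b1 b2\<close> as reciprocal roots. In the analytic normalization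
  the Hecke series is
  \<open>(\<Sum>d. \<lambda>(p^d) (p^(-3/2) X)^d) = (1 - \<omega>(p) X^2 / p) / Q(X)\<close>,
  and comparing coefficients gives the formula below (Andrianov).
\<close>

definition spin_poly :: "nat \<Rightarrow> nat \<Rightarrow> nat \<Rightarrow> siegel_form \<Rightarrow> nat \<Rightarrow> complex poly" where
  "spin_poly k1 k2 N F p =
     (let w = central_value k1 k2 N F p;
          e1 = hecke_T k1 k2 N F p * complex_of_real (real p powr (- 3 / 2));
          e2 = e1\<^sup>2 - hecke_T k1 k2 N F (p\<^sup>2) / of_nat p ^ 3 - w / of_nat p
      in [:1, - e1, e2, - w * e1, w\<^sup>2:])"

text \<open>
  The part of \<open>\<pi>\<^sub>F\<close> that is not read off from Hecke eigenvalues outside \<open>N\<close> and is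
  visible to the spinor L-function: the factors at the primes \<open>p\<close> dividing \<open>N\<close>, as
  polynomials in \<open>p^(-s)\<close>, and the conductor.
\<close>

record ramified_data =
  ram_poly :: "nat \<Rightarrow> complex poly"
  conductor :: nat

definition euler_poly ::
  "nat \<Rightarrow> nat \<Rightarrow> nat \<Rightarrow> siegel_form \<Rightarrow> ramified_data \<Rightarrow> nat \<Rightarrow> complex poly" where
  "euler_poly k1 k2 N F R p = (if p dvd N then ram_poly R p else spin_poly k1 k2 N F p)"

text \<open>
  Meromorphic continuation to \<open>C\<close> of the Euler product. The elementary bound \<open>p^(3/2)\<close> for
  Satake parameters gives absolute convergence for \<open>Re s > 5/2\<close>.
\<close>

definition continues_spin_euler_product ::
  "nat \<Rightarrow> nat \<Rightarrow> nat \<Rightarrow> siegel_form \<Rightarrow> ramified_data \<Rightarrow> (complex \<Rightarrow> complex) \<Rightarrow> bool" where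
  "continues_spin_euler_product k1 k2 N F R L \<longleftrightarrow>
     L nicely_meromorphic_on UNIV \<and>
     (\<forall>s. Re s > 5 / 2 \<longrightarrow>
        (\<lambda>p. if prime p then inverse (poly (euler_poly k1 k2 N F R p) (of_nat p powr (- s))) else 1)
          has_prod L s)"

definition spin_L ::
  "nat \<Rightarrow> nat \<Rightarrow> nat \<Rightarrow> siegel_form \<Rightarrow> ramified_data \<Rightarrow> complex \<Rightarrow> complex" where
  "spin_L k1 k2 N F R = (SOME L. continues_spin_euler_product k1 k2 N F R L)"

definition Gamma_C :: "complex \<Rightarrow> complex" where
  "Gamma_C s = 2 * of_real (2 * pi) powr (- s) * Gamma s"

definition completed_spin_L ::
  "nat \<Rightarrow> nat \<Rightarrow> nat \<Rightarrow> siegel_form \<Rightarrow> ramified_data \<Rightarrow> complex \<Rightarrow> complex" where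
  "completed_spin_L k1 k2 N F R s =
     of_nat (conductor R) powr (s / 2) *
     Gamma_C (s + of_real ((real k1 + real k2 - 3) / 2)) *
     Gamma_C (s + of_real ((real k1 - real k2 + 1) / 2)) *
     spin_L k1 k2 N F R s"

text \<open>
  What identifies \<open>R\<close> as belonging to \<open>\<pi>\<^sub>F\<close>: the factors at \<open>p\<close> dividing \<open>N\<close> have degree at most 4
  and reciprocal roots of absolute value at most \<open>p^(1/2)\<close> (equality occurs only for CAP
  representations), and the full Euler product continues and satisfies the functional equation
  relating it to the contragredient, whose coefficients are the complex conjugates.
  An identity of meromorphic functions holds off a sparse set.
\<close>

definition spin_ramified_data :: "nat \<Rightarrow> nat \<Rightarrow> nat \<Rightarrow> siegel_form \<Rightarrow> ramified_data \<Rightarrow> bool" where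
  "spin_ramified_data k1 k2 N F R \<longleftrightarrow>
     (\<forall>p. prime p \<and> p dvd N \<longrightarrow>
        coeff (ram_poly R p) 0 = 1 \<and> degree (ram_poly R p) \<le> 4 \<and>
        (\<forall>z. poly (ram_poly R p) z = 0 \<longrightarrow> real p powr (- 1 / 2) \<le> norm z)) \<and>
     0 < conductor R \<and> prime_factors (conductor R) \<subseteq> prime_factors N \<and>
     (\<exists>L. continues_spin_euler_product k1 k2 N F R L) \<and>
     (\<exists>\<epsilon>. norm \<epsilon> = 1 \<and>
        (\<forall>\<^sub>\<approx>s. completed_spin_L k1 k2 N F R s = \<epsilon> * cnj (completed_spin_L k1 k2 N F R (1 - cnj s))))"

text \<open>
  Zeros in the open strip. Trivial zeros (poles of the Gamma factors) have negative real part.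
  Multiplicity is \<open>zorder\<close>, which is positive exactly at zeros.
\<close>

definition nontrivial_zeros :: "(complex \<Rightarrow> complex) \<Rightarrow> complex set" where
  "nontrivial_zeros L = {\<rho>. 0 < Re \<rho> \<and> Re \<rho> < 1 \<and> 0 < zorder L \<rho>}"

definition GRH_for :: "(complex \<Rightarrow> complex) \<Rightarrow> bool" where
  "GRH_for L \<longleftrightarrow> (\<forall>\<rho> \<in> nontrivial_zeros L. Re \<rho> = 1 / 2)"

text \<open>
  Analytic conductor in the form of Iwaniec and Kowalski: the conductor times the product of
  \<open>|\<kappa>| + 3\<close> over the four shifts \<open>\<kappa>\<close> in
  \<open>\<Gamma>\<^sub>C(s + a) \<Gamma>\<^sub>C(s + b) = \<Gamma>\<^sub>R(s + a) \<Gamma>\<^sub>R(s + a + 1) \<Gamma>\<^sub>R(s + b) \<Gamma>\<^sub>R(s + b + 1)\<close>.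
\<close>

definition analytic_conductor :: "nat \<Rightarrow> nat \<Rightarrow> ramified_data \<Rightarrow> real" where
  "analytic_conductor k1 k2 R =
     (let a = (real k1 + real k2 - 3) / 2; b = (real k1 - real k2 + 1) / 2
      in real (conductor R) * (\<bar>a\<bar> + 3) * (\<bar>a + 1\<bar> + 3) * (\<bar>b\<bar> + 3) * (\<bar>b + 1\<bar> + 3))"


section \<open>One-level density\<close>

text \<open>
  An eigenbasis and the ramified data for every triple \<open>(k1, k2, N)\<close> of weights and level.
\<close>

type_synonym basis_family = "nat \<times> nat \<times> nat \<Rightarrow> siegel_form set"
type_synonym ramified_family = "nat \<times> nat \<times> nat \<Rightarrow> siegel_form \<Rightarrow> ramified_data"

definition average :: "siegel_form set \<Rightarrow> (siegel_form \<Rightarrow> real) \<Rightarrow> real" where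
  "average B f = (\<Sum>F\<in>B. f F) / real (card B)"

fun family_L :: "ramified_family \<Rightarrow> nat \<times> nat \<times> nat \<Rightarrow> siegel_form \<Rightarrow> complex \<Rightarrow> complex" where
  "family_L R (k1, k2, N) F = spin_L k1 k2 N F (R (k1, k2, N) F)"

fun log_average_conductor :: "basis_family \<Rightarrow> ramified_family \<Rightarrow> nat \<times> nat \<times> nat \<Rightarrow> real" where
  "log_average_conductor HE R (k1, k2, N) =
     average (HE (k1, k2, N)) (\<lambda>F. ln (analytic_conductor k1 k2 (R (k1, k2, N) F)))"

text \<open>The ordinate \<open>\<gamma>\<close> of a zero is its imaginary part; under GRH the zero is \<open>1/2 + i \<gamma>\<close>.\<close>

definition D_term :: "(complex \<Rightarrow> complex) \<Rightarrow> real \<Rightarrow> (real \<Rightarrow> real) \<Rightarrow> complex \<Rightarrow> real" where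
  "D_term L logc \<phi> \<rho> = real_of_int (zorder L \<rho>) * \<phi> (Im \<rho> / (2 * pi) * logc)"

definition D_sum :: "(complex \<Rightarrow> complex) \<Rightarrow> real \<Rightarrow> (real \<Rightarrow> real) \<Rightarrow> real" where
  "D_sum L logc \<phi> = (\<Sum>\<^sub>\<infinity>\<rho>\<in>nontrivial_zeros L. D_term L logc \<phi> \<rho>)"

definition fourier :: "(real \<Rightarrow> real) \<Rightarrow> real \<Rightarrow> complex" where
  "fourier \<phi> \<xi> = (LINT x|lborel. complex_of_real (\<phi> x) * cis (- 2 * pi * x * \<xi>))"

text \<open>
  Decay of order \<open>x^(-2)\<close> makes the sums over zeros converge absolutely and admits the Fejer
  kernel, which a Schwartz class would exclude.
\<close>

definition test_function :: "(real \<Rightarrow> real) \<Rightarrow> bool" where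
  "test_function \<phi> \<longleftrightarrow> (\<forall>x. \<phi> (- x) = \<phi> x) \<and> continuous_on UNIV \<phi> \<and>
     (\<exists>C. \<forall>x. \<bar>\<phi> x\<bar> \<le> C / (1 + x\<^sup>2))"

text \<open>The Fourier transform is nonzero only inside the open interval \<open>(-u, u)\<close>.\<close>

definition fourier_supported :: "(real \<Rightarrow> real) \<Rightarrow> real \<Rightarrow> bool" where
  "fourier_supported \<phi> u \<longleftrightarrow> {\<xi>. fourier \<phi> \<xi> \<noteq> 0} \<subseteq> {-u<..<u}"

text \<open>
  The two limits, as filters on triples \<open>(k1, k2, N)\<close>. Averages only make sense when the space
  of cusp forms is nonzero (it vanishes, for instance, for \<open>N = 1\<close> and \<open>k1 - k2\<close> odd).
\<close>

definition level_aspect :: "basis_family \<Rightarrow> nat \<Rightarrow> nat \<Rightarrow> (nat \<times> nat \<times> nat) filter" where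
  "level_aspect HE k1 k2 = inf (filtercomap (\<lambda>(_, _, N). N) at_top)
     (principal {(l1, l2, N). l1 = k1 \<and> l2 = k2 \<and> coprime N (fact 11) \<and> HE (l1, l2, N) \<noteq> {}})"

definition weight_aspect :: "basis_family \<Rightarrow> nat \<Rightarrow> (nat \<times> nat \<times> nat) filter" where
  "weight_aspect HE N = inf (filtercomap (\<lambda>(k1, k2, _). k1 + k2) at_top)
     (principal {(k1, k2, M). M = N \<and> 3 \<le> k2 \<and> k2 \<le> k1 \<and> HE (k1, k2, M) \<noteq> {}})"

fun level_error :: "nat \<times> nat \<times> nat \<Rightarrow> real" where
  "level_error (k1, k2, N) = 1 / ln (ln (real N))"

fun weight_error :: "nat \<times> nat \<times> nat \<Rightarrow> real" where
  "weight_error (k1, k2, N) = 1 / ln ((real k1 - real k2 + 2) * real k1 * real k2)"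

text \<open>
  The formula along a filter \<open>X\<close> with error \<open>O(h)\<close>. The implied constant may depend on \<open>\<phi>\<close>.
  The formula includes the convergence of the sums over zeros, since \<open>infsum\<close> of a divergent sum
  is 0. For even real \<open>\<phi>\<close> the Fourier transform is real.
\<close>

definition one_level_density_formula ::
  "basis_family \<Rightarrow> ramified_family \<Rightarrow> real \<Rightarrow> (nat \<times> nat \<times> nat) filter \<Rightarrow>
   (nat \<times> nat \<times> nat \<Rightarrow> real) \<Rightarrow> bool" where
  "one_level_density_formula HE R u X h \<longleftrightarrow> (\<forall>\<phi>. test_function \<phi> \<and> fourier_supported \<phi> u \<longrightarrow>
     (\<forall>\<^sub>F \<kappa> in X. \<forall>F \<in> HE \<kappa>.
        D_term (family_L R \<kappa> F) (log_average_conductor HE R \<kappa>) \<phi>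
          summable_on nontrivial_zeros (family_L R \<kappa> F)) \<and>
     (\<lambda>\<kappa>. average (HE \<kappa>) (\<lambda>F. D_sum (family_L R \<kappa> F) (log_average_conductor HE R \<kappa>) \<phi>)
            - (Re (fourier \<phi> 0) + \<phi> 0 / 2)) \<in> O[X](h))"

definition central_order :: "ramified_family \<Rightarrow> nat \<times> nat \<times> nat \<Rightarrow> siegel_form \<Rightarrow> int" where
  "central_order R \<kappa> F = zorder (family_L R \<kappa> F) (1 / 2)"

end

theory Submission
  imports Defs "HOL-Probability.Sinc_Integral" "HOL-Real_Asymp.Real_Asymp"
begin

text \<open>
  The bound comes from testing the one-level density formula against a single function, the
  Fejer kernel \<open>\<phi>(x) = (sin (\<pi> u x) / (\<pi> u x))\<^sup>2\<close>. It is nonnegative and equals 1 at the origin,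
  and the ordinates at which it is evaluated are real. Hence all zeros contribute nonnegatively
  to the sum over zeros of \<open>L(s, \<pi>\<^sub>F, Spin)\<close>, while a zero at \<open>s = 1/2\<close> contributes exactly its
  multiplicity: the order of vanishing \<open>r\<^sub>F\<close> is at most \<open>D(\<pi>\<^sub>F, \<phi>, Spin)\<close>
  (\<open>zorder_half_le_D_sum\<close>). Averaging over the family, the density formula turns this into
  the bound \<open>fourier \<phi> 0 + \<phi> 0 / 2 + E = 1/u + 1/2 + E\<close> (\<open>average_central_order_le\<close>), in either
  aspect, with the error \<open>E\<close> of the density formula at this one \<open>\<phi>\<close>.

  For this \<open>\<phi>\<close> has to be admissible. Its Fourier transform is the triangle
  \<open>\<xi> \<mapsto> max 0 (u - \<bar>\<xi>\<bar>) / u\<^sup>2\<close>, which vanishes outside the open interval \<open>(-u, u)\<close> and has the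
  value \<open>1/u\<close> at 0 (\<open>fourier_fejer_kernel\<close>). The transform is computed by
  elementary means: \<open>\<phi>(x) cos (2 \<pi> \<xi> x)\<close> is a combination of three functions
  \<open>(1 - cos (t x)) / x\<^sup>2\<close>, whose integral over the line is \<open>\<pi> \<bar>t\<bar>\<close>; up to scaling this is the
  integral of \<open>(sin x / x)\<^sup>2\<close>, which integration by parts reduces to the Dirichlet integral.
\<close>

section \<open>The integral of the squared sinc function\<close>

lemma sinc_sq_le_1: "(sinc x)\<^sup>2 \<le> 1"
proof -
  have "\<bar>sin x\<bar> \<le> \<bar>x\<bar>" by (rule abs_sin_x_le_abs_x)
  then have "\<bar>sinc x\<bar> \<le> 1" by (auto simp: divide_simps)
  then show ?thesis by (simp add: abs_square_le_1)
qed

text \<open>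
  Integration by parts: \<open>(sin x)\<^sup>2\<close> has derivative \<open>sin (2 x)\<close>, so integrating \<open>(sin x)\<^sup>2 / x\<^sup>2\<close>
  leaves the boundary term \<open>- (sin x)\<^sup>2 / x\<close> and the integral of \<open>sin (2 x) / x\<close>, which is
  \<open>Si (2 x)\<close>. Writing the boundary term through \<open>sinc\<close> makes the antiderivative valid at 0 as well.
\<close>
lemma DERIV_sinc_sq_antiderivative:
  "((\<lambda>x. Si (2 * x) - x * (sinc x)\<^sup>2) has_real_derivative (sinc y)\<^sup>2) (at y)"
proof (cases "y = 0")
  case True
  have "isCont (\<lambda>x. (sinc x)\<^sup>2) 0"
    by (intro continuous_power isCont_sinc)
  then have "(\<lambda>h. (sinc h)\<^sup>2) \<midarrow>0\<rightarrow> 1"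
    by (simp add: isCont_def)
  then have "(\<lambda>h. (h * (sinc h)\<^sup>2) / h) \<midarrow>0\<rightarrow> 1"
    by (rule Lim_transform_eventually) (simp add: eventually_at_filter)
  then have "((\<lambda>x. x * (sinc x)\<^sup>2) has_real_derivative 1) (at 0)"
    by (simp only: DERIV_def add_0 mult_zero_left diff_zero)
  moreover have "((\<lambda>x. Si (2 * x)) has_real_derivative sinc (2 * 0) * 2) (at 0)"
    by (rule DERIV_chain'[OF _ DERIV_Si]) (auto intro!: derivative_eq_intros)
  ultimately have "((\<lambda>x. Si (2 * x) - x * (sinc x)\<^sup>2) has_real_derivative sinc (2 * 0) * 2 - 1) (at 0)"
    by (intro DERIV_diff)
  then show ?thesis using True by simp
next
  case False
  have S: "((\<lambda>x. Si (2 * x)) has_real_derivative sinc (2 * y) * 2) (at y)"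
    by (rule DERIV_chain'[OF _ DERIV_Si]) (auto intro!: derivative_eq_intros)
  have "((\<lambda>x. (sin x)\<^sup>2 / x) has_real_derivative (2 * sin y * cos y * y - (sin y)\<^sup>2) / y\<^sup>2) (at y)"
    using False by (auto intro!: derivative_eq_intros simp: power2_eq_square)
  moreover have "(sin x)\<^sup>2 / x = x * (sinc x)\<^sup>2" for x
    by (simp add: power2_eq_square)
  ultimately have Q: "((\<lambda>x. x * (sinc x)\<^sup>2) has_real_derivative
      (2 * sin y * cos y * y - (sin y)\<^sup>2) / y\<^sup>2) (at y)"
    by simp
  have "sinc (2 * y) * 2 - (2 * sin y * cos y * y - (sin y)\<^sup>2) / y\<^sup>2 = (sinc y)\<^sup>2"
    using False sin_double[of y] by (simp add: power2_eq_square field_simps)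
  then show ?thesis
    using DERIV_diff[OF S Q] by simp
qed

text \<open>
  The antiderivative vanishes at 0 and tends to \<open>pi / 2\<close>, the value of the Dirichlet integral,
  because the boundary term is \<open>O(1 / x)\<close>. Evenness doubles the integral over the half line.
\<close>
lemma has_bochner_integral_sinc_sq: "has_bochner_integral lborel (\<lambda>x. (sinc x)\<^sup>2) pi"
proof -
  have "((\<lambda>x. x * (sinc x)\<^sup>2) \<longlongrightarrow> 0) at_top"
  proof (rule Lim_null_comparison)
    show "\<forall>\<^sub>F x in at_top. norm (x * (sinc x)\<^sup>2) \<le> 1 / x"
      using eventually_gt_at_top[of 0]
    proof eventually_elim
      case (elim x)
      have "norm (x * (sinc x)\<^sup>2) = (sin x)\<^sup>2 / x"
        using elim by (simp add: abs_mult power2_eq_square)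
      also have "\<dots> \<le> 1 / x"
        using elim by (intro divide_right_mono) (auto simp: abs_square_le_1)
      finally show ?case .
    qed
    show "((\<lambda>x::real. 1 / x) \<longlongrightarrow> 0) at_top"
      by real_asymp
  qed
  moreover have "((\<lambda>x. Si (2 * x)) \<longlongrightarrow> pi / 2) at_top"
    by (rule filterlim_compose[OF Si_at_top]) real_asymp
  ultimately have lim: "((\<lambda>x. Si (2 * x) - x * (sinc x)\<^sup>2) \<longlongrightarrow> pi / 2 - 0) at_top"
    by (intro tendsto_diff)
  have Si0: "Si 0 = 0"
    using Si_neg[of 0] by simp
  have "(\<integral>\<^sup>+x. ennreal ((sinc x)\<^sup>2) * indicator {0..} x \<partial>lborel) =
      ennreal (pi / 2 - 0 - (Si (2 * 0) - 0 * (sinc 0)\<^sup>2))"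
    by (rule nn_integral_FTC_atLeast[OF _ DERIV_sinc_sq_antiderivative _ lim]) auto
  moreover have "ennreal (indicator {0..} x *\<^sub>R (sinc x)\<^sup>2) = ennreal ((sinc x)\<^sup>2) * indicator {0..} x" for x
    by (simp split: split_indicator)
  ultimately have "(\<integral>\<^sup>+x. ennreal (indicator {0..} x *\<^sub>R (sinc x)\<^sup>2) \<partial>lborel) = ennreal (pi / 2)"
    by (simp only: Si0 mult_zero_right mult_zero_left diff_zero)
  then have "has_bochner_integral lborel (\<lambda>x. indicator {0..} x *\<^sub>R (sinc x)\<^sup>2) (pi / 2)"
    by (intro has_bochner_integral_nn_integral) auto
  from has_bochner_integral_even_function[OF this] show ?thesis
    by simp
qed

text \<open>
  The half-angle formula gives \<open>1 - cos (t x) = 2 (sin (t x / 2))\<^sup>2\<close>, so away from \<open>x = 0\<close> the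
  integrand is \<open>t\<^sup>2 / 2\<close> times the squared sinc function at \<open>t x / 2\<close>. The kink of \<open>\<bar>t\<bar>\<close> at 0 is
  what later produces the corners of the triangle.
\<close>
lemma has_bochner_integral_one_minus_cos:
  "has_bochner_integral lborel (\<lambda>x. (1 - cos (t * x)) / x\<^sup>2) (pi * \<bar>t\<bar>)"
proof (cases "t = 0")
  case False
  have "has_bochner_integral lborel (\<lambda>x. (sinc (0 + (t / 2) * x))\<^sup>2) (pi /\<^sub>R \<bar>t / 2\<bar>)"
    using lborel_has_bochner_integral_real_affine_iff[of "t / 2" "\<lambda>x. (sinc x)\<^sup>2" pi 0] False
      has_bochner_integral_sinc_sq by simp
  then have "has_bochner_integral lborel (\<lambda>x. t\<^sup>2 / 2 * (sinc (0 + (t / 2) * x))\<^sup>2)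
      (t\<^sup>2 / 2 * (pi /\<^sub>R \<bar>t / 2\<bar>))"
    by (rule has_bochner_integral_mult_right)
  moreover have "t\<^sup>2 / 2 * (pi /\<^sub>R \<bar>t / 2\<bar>) = pi * \<bar>t\<bar>"
    using False by (simp add: field_simps power2_eq_square abs_if)
  moreover have eq: "t\<^sup>2 / 2 * (sinc (0 + (t / 2) * x))\<^sup>2 = (1 - cos (t * x)) / x\<^sup>2" if "x \<noteq> 0" for x
    using that False cos_double_sin[of "t / 2 * x"] by (simp add: field_simps power2_eq_square)
  have "AE x in lborel. t\<^sup>2 / 2 * (sinc (0 + (t / 2) * x))\<^sup>2 = (1 - cos (t * x)) / x\<^sup>2"
    using AE_lborel_singleton[of 0] by eventually_elim (rule eq)
  ultimately show ?thesis
    by (subst has_bochner_integral_cong_AE[symmetric]) auto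
qed (simp add: has_bochner_integral_zero)


section \<open>The Fejer kernel\<close>

text \<open>
  The normalization is by the value 1 at the origin, so that a central zero is counted with its
  multiplicity; the parameter \<open>u\<close> is the half-width of the support of the Fourier transform.
\<close>
definition fejer_kernel :: "real \<Rightarrow> real \<Rightarrow> real" where
  "fejer_kernel u x = (sinc (pi * u * x))\<^sup>2"

lemma fejer_kernel_nonneg: "0 \<le> fejer_kernel u x"
  by (simp add: fejer_kernel_def)

lemma fejer_kernel_0 [simp]: "fejer_kernel u 0 = 1"
  by (simp add: fejer_kernel_def)

lemma fejer_kernel_minus [simp]: "fejer_kernel u (- x) = fejer_kernel u x"
  by (simp add: fejer_kernel_def)

lemma test_function_fejer_kernel:
  assumes "0 < u"
  shows "test_function (fejer_kernel u)"
proof -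
  \<comment> \<open>The constant in the decay bound is the sum of the bounds 1 for \<open>\<phi>(x)\<close> and \<open>1 / a\<^sup>2\<close> for \<open>x\<^sup>2 \<phi>(x)\<close>.\<close>
  define a where "a = pi * u"
  have a: "a > 0" using assms by (simp add: a_def)
  have "\<bar>fejer_kernel u x\<bar> \<le> (1 + 1 / a\<^sup>2) / (1 + x\<^sup>2)" for x
  proof -
    have 1: "fejer_kernel u x \<le> 1"
      using sinc_sq_le_1[of "pi * u * x"] by (simp only: fejer_kernel_def)
    have "a\<^sup>2 * (x\<^sup>2 * fejer_kernel u x) = (sin (a * x))\<^sup>2"
      using a by (simp add: fejer_kernel_def power_divide power_mult_distrib flip: a_def)
    also have "\<dots> \<le> 1" by (simp add: abs_square_le_1)
    finally have "x\<^sup>2 * fejer_kernel u x \<le> 1 / a\<^sup>2"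
      using a by (simp add: field_simps)
    with 1 have "(1 + x\<^sup>2) * fejer_kernel u x \<le> 1 + 1 / a\<^sup>2"
      by (simp add: algebra_simps)
    moreover have "1 + x\<^sup>2 > 0" by (simp add: add_pos_nonneg)
    ultimately show ?thesis
      by (simp add: pos_le_divide_eq mult.commute fejer_kernel_nonneg)
  qed
  moreover have "continuous_on UNIV (fejer_kernel u)"
    unfolding fejer_kernel_def by (intro continuous_intros)
  ultimately show ?thesis
    unfolding test_function_def by auto
qed

text \<open>
  With \<open>p = \<pi> u x\<close> and \<open>q = 2 \<pi> \<xi> x\<close>, the product formula gives
  \<open>4 (sin p)\<^sup>2 cos q = 2 cos q - cos (2 p + q) - cos (2 p - q)\<close>. The coefficients on the right sum to
  zero, so each cosine may be replaced by \<open>cos - 1\<close>, and after division by \<open>x\<^sup>2\<close> each term is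
  integrable by itself. The integrals combine to a multiple of \<open>\<bar>u + \<xi>\<bar> + \<bar>u - \<xi>\<bar> - 2 \<bar>\<xi>\<bar>\<close>, which
  equals \<open>2 max 0 (u - \<bar>\<xi>\<bar>)\<close>.
\<close>
lemma has_bochner_integral_fejer_kernel_cos:
  assumes "0 < u"
  shows "has_bochner_integral lborel (\<lambda>x. fejer_kernel u x * cos (2 * pi * \<xi> * x))
           (max 0 (u - \<bar>\<xi>\<bar>) / u\<^sup>2)"
proof -
  let ?J = "\<lambda>t x::real. (1 - cos (t * x)) / x\<^sup>2"
  let ?a = "2 * pi * (u + \<xi>)" and ?b = "2 * pi * (u - \<xi>)" and ?c = "2 * pi * \<xi>"
  let ?k = "1 / (4 * (pi * u)\<^sup>2)"
  have "has_bochner_integral lborel (\<lambda>x. ?k * (?J ?a x + ?J ?b x - 2 * ?J ?c x))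
      (?k * (pi * \<bar>?a\<bar> + pi * \<bar>?b\<bar> - 2 * (pi * \<bar>?c\<bar>)))"
    by (intro has_bochner_integral_mult_right has_bochner_integral_diff has_bochner_integral_add
        has_bochner_integral_one_minus_cos)
  moreover have "?k * (pi * \<bar>?a\<bar> + pi * \<bar>?b\<bar> - 2 * (pi * \<bar>?c\<bar>)) = max 0 (u - \<bar>\<xi>\<bar>) / u\<^sup>2"
  proof -
    have "\<bar>u + \<xi>\<bar> + \<bar>u - \<xi>\<bar> - 2 * \<bar>\<xi>\<bar> = 2 * max 0 (u - \<bar>\<xi>\<bar>)"
      using assms by (auto simp: max_def abs_if)
    then have "pi * \<bar>?a\<bar> + pi * \<bar>?b\<bar> - 2 * (pi * \<bar>?c\<bar>) = 2 * pi\<^sup>2 * (2 * max 0 (u - \<bar>\<xi>\<bar>))"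
      by (simp add: abs_mult power2_eq_square flip: right_diff_distrib distrib_left)
         (simp add: algebra_simps)
    then show ?thesis
      using assms by (simp add: power2_eq_square field_simps)
  qed
  moreover have eq: "?k * (?J ?a x + ?J ?b x - 2 * ?J ?c x) = fejer_kernel u x * cos (2 * pi * \<xi> * x)"
    if "x \<noteq> 0" for x
  proof -
    define p q where "p = pi * u * x" and "q = 2 * pi * \<xi> * x"
    have "?a * x = 2 * p + q" "?b * x = 2 * p - q" "?c * x = q"
      by (simp_all add: p_def q_def algebra_simps)
    then have "?J ?a x + ?J ?b x - 2 * ?J ?c x = (2 * cos q - (cos (2 * p + q) + cos (2 * p - q))) / x\<^sup>2"
      by (simp add: add_divide_distrib diff_divide_distrib)
    also have "2 * cos q - (cos (2 * p + q) + cos (2 * p - q)) = 2 * cos q * (1 - cos (2 * p))"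
      by (simp add: cos_add cos_diff algebra_simps)
    also have "1 - cos (2 * p) = 2 * (sin p)\<^sup>2"
      by (simp add: cos_double_sin)
    finally show ?thesis
      using that assms by (simp add: fejer_kernel_def power_mult_distrib power_divide
          flip: p_def q_def) (simp add: p_def power_mult_distrib)
  qed
  have "AE x in lborel. ?k * (?J ?a x + ?J ?b x - 2 * ?J ?c x) =
      fejer_kernel u x * cos (2 * pi * \<xi> * x)"
    using AE_lborel_singleton[of 0] by eventually_elim (rule eq)
  ultimately show ?thesis
    unfolding fejer_kernel_def by (subst has_bochner_integral_cong_AE[symmetric]) auto
qed

lemma fourier_even:
  assumes even: "\<And>x. \<phi> (- x) = \<phi> x" and int: "integrable lborel \<phi>"
  shows "fourier \<phi> \<xi> = complex_of_real (LINT x|lborel. \<phi> x * cos (2 * pi * \<xi> * x))"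
proof -
  let ?f = "\<lambda>x. complex_of_real (\<phi> x) * cis (- 2 * pi * x * \<xi>)"
  have meas [measurable]: "\<phi> \<in> borel_measurable lborel"
    using int by (rule borel_measurable_integrable)
  have f: "integrable lborel ?f"
    by (rule Bochner_Integration.integrable_bound[OF int]) (auto simp: norm_mult cis_conv_exp)
  have "Re (fourier \<phi> \<xi>) = (LINT x|lborel. \<phi> x * cos (2 * pi * \<xi> * x))"
    unfolding fourier_def using f by (simp flip: integral_Re add: mult_ac)
  \<comment> \<open>The sine part is odd: the substitution \<open>x \<mapsto> - x\<close> equates its integral to its own negative.\<close>
  moreover have "Im (fourier \<phi> \<xi>) = 0"
  proof -
    let ?s = "\<lambda>x. \<phi> x * sin (- 2 * pi * x * \<xi>)"
    have "Im (fourier \<phi> \<xi>) = (LINT x|lborel. ?s x)"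
      unfolding fourier_def using f by (simp flip: integral_Im)
    moreover have "(LINT x|lborel. ?s x) = (LINT x|lborel. ?s (0 + - 1 * x))"
      using lborel_integral_real_affine[of "- 1" ?s 0] by simp
    moreover have "\<dots> = - (LINT x|lborel. ?s x)"
      by (simp add: even)
    ultimately show ?thesis by simp
  qed
  ultimately show ?thesis by (simp add: complex_eq_iff)
qed

lemma fourier_fejer_kernel:
  assumes "0 < u"
  shows "fourier (fejer_kernel u) \<xi> = complex_of_real (max 0 (u - \<bar>\<xi>\<bar>) / u\<^sup>2)"
proof -
  have "integrable lborel (fejer_kernel u)"
    using has_bochner_integral_fejer_kernel_cos[OF assms, of 0] by (simp add: has_bochner_integral_iff)
  then show ?thesis
    using has_bochner_integral_fejer_kernel_cos[OF assms, of \<xi>]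
    by (subst fourier_even) (auto simp: has_bochner_integral_iff)
qed

lemma fourier_supported_fejer_kernel:
  assumes "0 < u"
  shows "fourier_supported (fejer_kernel u) u"
  using assms by (auto simp: fourier_supported_def fourier_fejer_kernel max_def split: if_splits)


section \<open>Bounding the order of vanishing by the one-level density\<close>

text \<open>
  All terms of the sum over zeros are nonnegative, so the sum dominates the single term at
  \<open>1 / 2\<close>, which is the order of vanishing itself as \<open>\<phi> 0 = 1\<close>. If \<open>1 / 2\<close> is not a zero, then
  the order is at most 0 and the nonnegativity of the sum suffices.
\<close>
lemma zorder_half_le_D_sum:
  assumes nonneg: "\<And>x. 0 \<le> \<phi> x" and "\<phi> 0 = 1"
    and summable: "D_term L c \<phi> summable_on nontrivial_zeros L"
  shows "real_of_int (zorder L (1 / 2)) \<le> D_sum L c \<phi>"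
proof -
  have term_nonneg: "0 \<le> D_term L c \<phi> \<rho>" if "\<rho> \<in> nontrivial_zeros L" for \<rho>
    using that nonneg by (auto simp: D_term_def nontrivial_zeros_def)
  show ?thesis
  proof (cases "0 < zorder L (1 / 2)")
    case True
    then have "(\<Sum>\<rho>\<in>{1 / 2}. D_term L c \<phi> \<rho>) \<le> D_sum L c \<phi>"
      unfolding D_sum_def
      by (intro finite_sum_le_infsum[OF summable] term_nonneg) (auto simp: nontrivial_zeros_def)
    then show ?thesis
      by (simp add: D_term_def \<open>\<phi> 0 = 1\<close>)
  next
    case False
    moreover have "0 \<le> D_sum L c \<phi>"
      unfolding D_sum_def by (intro infsum_nonneg term_nonneg)
    ultimately show ?thesis by linarith
  qed
qed

lemma average_mono:
  assumes "\<And>F. F \<in> B \<Longrightarrow> f F \<le> g F"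
  shows "average B f \<le> average B g"
  unfolding average_def by (intro divide_right_mono sum_mono assms) auto

text \<open>
  The argument is the same along any filter \<open>X\<close> on weights and levels, so the level and the
  weight aspect are two instances.
\<close>
lemma average_central_order_le:
  assumes "0 < u" and density: "one_level_density_formula HE R u X h"
  shows "\<exists>E \<in> O[X](h). \<forall>\<^sub>F \<kappa> in X.
           average (HE \<kappa>) (\<lambda>F. real_of_int (central_order R \<kappa> F)) \<le> 1 / u + 1 / 2 + E \<kappa>"
proof -
  let ?\<phi> = "fejer_kernel u"
  let ?D = "\<lambda>\<kappa>. average (HE \<kappa>) (\<lambda>F. D_sum (family_L R \<kappa> F) (log_average_conductor HE R \<kappa>) ?\<phi>)"
  define E where "E \<kappa> = ?D \<kappa> - (1 / u + 1 / 2)" for \<kappa>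
  have fourier0: "Re (fourier ?\<phi> 0) = 1 / u"
    using assms(1) by (simp add: fourier_fejer_kernel power2_eq_square)
  have summable: "\<forall>\<^sub>F \<kappa> in X. \<forall>F \<in> HE \<kappa>.
        D_term (family_L R \<kappa> F) (log_average_conductor HE R \<kappa>) ?\<phi>
          summable_on nontrivial_zeros (family_L R \<kappa> F)"
    and bigo: "(\<lambda>\<kappa>. ?D \<kappa> - (Re (fourier ?\<phi> 0) + ?\<phi> 0 / 2)) \<in> O[X](h)"
    using density test_function_fejer_kernel[OF assms(1)] fourier_supported_fejer_kernel[OF assms(1)]
    unfolding one_level_density_formula_def by blast+
  have "E \<in> O[X](h)"
    using bigo by (simp add: E_def[abs_def] fourier0)
  moreover have "\<forall>\<^sub>F \<kappa> in X.
      average (HE \<kappa>) (\<lambda>F. real_of_int (central_order R \<kappa> F)) \<le> 1 / u + 1 / 2 + E \<kappa>"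
    using summable
  proof eventually_elim
    case (elim \<kappa>)
    then have "average (HE \<kappa>) (\<lambda>F. real_of_int (central_order R \<kappa> F)) \<le> ?D \<kappa>"
      unfolding central_order_def
      by (intro average_mono zorder_half_le_D_sum fejer_kernel_nonneg) auto
    then show ?case by (simp add: E_def)
  qed
  ultimately show ?thesis by blast
qed

theorem theorem10p3:
  fixes HE :: basis_family and R :: ramified_family
  assumes eigenbasis: "\<And>k1 k2 N. 3 \<le> k2 \<Longrightarrow> k2 \<le> k1 \<Longrightarrow> coprime N (fact 11) \<Longrightarrow>
      hecke_eigenbasis k1 k2 N (HE (k1, k2, N))"
    and ramified: "\<And>k1 k2 N F. 3 \<le> k2 \<Longrightarrow> k2 \<le> k1 \<Longrightarrow> coprime N (fact 11) \<Longrightarrow>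
      F \<in> HE (k1, k2, N) \<Longrightarrow> spin_ramified_data k1 k2 N F (R (k1, k2, N) F)"
    and GRH: "\<And>k1 k2 N F. 3 \<le> k2 \<Longrightarrow> k2 \<le> k1 \<Longrightarrow> coprime N (fact 11) \<Longrightarrow>
      F \<in> HE (k1, k2, N) \<Longrightarrow> GRH_for (family_L R (k1, k2, N) F)"
  shows "(\<forall>k1 k2 u. 3 \<le> k2 \<and> k2 \<le> k1 \<and> 0 < u \<and> u < 1 \<and>
            one_level_density_formula HE R u (level_aspect HE k1 k2) level_error \<longrightarrow>
            (\<exists>E \<in> O[level_aspect HE k1 k2](level_error).
               \<forall>\<^sub>F \<kappa> in level_aspect HE k1 k2.
                 average (HE \<kappa>) (\<lambda>F. real_of_int (central_order R \<kappa> F)) \<le> 1 / u + 1 / 2 + E \<kappa>))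
       \<and> (\<forall>N u. coprime N (fact 11) \<and> 0 < u \<and> u < 1 \<and>
            one_level_density_formula HE R u (weight_aspect HE N) weight_error \<longrightarrow>
            (\<exists>E \<in> O[weight_aspect HE N](weight_error).
               \<forall>\<^sub>F \<kappa> in weight_aspect HE N.
                 average (HE \<kappa>) (\<lambda>F. real_of_int (central_order R \<kappa> F)) \<le> 1 / u + 1 / 2 + E \<kappa>))"
  by (intro conjI allI impI average_central_order_le) auto

end
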